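(* Let $\mathbb{X}$ be a finite-dimensional Euclidean space and suppose that $g=\sigma_C:\mathbb{X}\to\mathbb{R}\cup\{+\infty\}$ is the support function of a nonempty closed convex set $C\subset\mathbb{X}$. Then $\operatorname{par}\partial g^*(z)=\operatorname{span}N_C(z)$ for any $z\in C$.
   Context: $\sigma_C(v)=\sup_{x\in C}\langle v,x\rangle$; $g^*$ is the Legendre–Fenchel conjugate of $g$; $\partial$ is the convex subdifferential; $N_C(z)=\{v\in\mathbb{X}\mid\langle v,y-z\rangle\le0\ \forall y\in C\}$ is the normal cone. For a nonempty convex set $D$, its parallel subspace is $\operatorname{par}D:=\operatorname{span}(D-x)$ for any $x\in D$. *)

theory Defs
  imports "HOL-Analysis.Analysis"
begin

definition support_function :: "'a::real_inner set \<Rightarrow> 'a \<Rightarrow> ereal" where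
  "support_function C v = (SUP x\<in>C. ereal (inner v x))"

definition fenchel_conjugate :: "('a::real_inner \<Rightarrow> ereal) \<Rightarrow> 'a \<Rightarrow> ereal" where
  "fenchel_conjugate g z = (SUP v. ereal (inner z v) - g v)"

text \<open>By the usual convention the subdifferential is empty at points where \<open>f\<close> is not finite.\<close>

definition subdifferential :: "('a::real_inner \<Rightarrow> ereal) \<Rightarrow> 'a \<Rightarrow> 'a set" where
  "subdifferential f x =
     {v. \<bar>f x\<bar> \<noteq> \<infinity> \<and> (\<forall>y. f x + ereal (inner v (y - x)) \<le> f y)}"

definition normal_cone :: "'a::real_inner set \<Rightarrow> 'a \<Rightarrow> 'a set" where
  "normal_cone C z = {v. \<forall>y\<in>C. inner v (y - z) \<le> 0}"

text \<open>For nonempty \<open>D\<close> the choice of the base point is immaterial, see \<open>par_eq\<close>.\<close>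

definition par :: "'a::real_vector set \<Rightarrow> 'a set" where
  "par D = span ((\<lambda>y. y - (SOME x. x \<in> D)) ` D)"

lemma span_diff_base_subset:
  fixes D :: "'a::real_vector set"
  assumes "x \<in> D"
  shows "span ((\<lambda>y. y - x) ` D) \<subseteq> span ((\<lambda>y. y - w) ` D)"
proof (rule span_minimal)
  show "(\<lambda>y. y - x) ` D \<subseteq> span ((\<lambda>y. y - w) ` D)"
  proof clarify
    fix y assume "y \<in> D"
    then have "(y - w) - (x - w) \<in> span ((\<lambda>y. y - w) ` D)"
      using assms by (intro span_diff span_base) auto
    then show "y - x \<in> span ((\<lambda>y. y - w) ` D)" by simp
  qed
qed simp

lemma par_eq:
  assumes "x \<in> D"
  shows "par D = span ((\<lambda>y. y - x) ` D)"
proof -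
  have "(SOME x. x \<in> D) \<in> D" using assms by (rule someI)
  then show ?thesis
    unfolding par_def using assms by (intro equalityI span_diff_base_subset)
qed

end

theory Submission
  imports Defs
begin

text \<open>The subdifferential of the conjugate \<open>\<sigma>\<^sub>C\<^sup>*\<close> at a point \<open>z \<in> C\<close> is the normal cone
  \<open>N\<^sub>C(z)\<close>; since the cone contains the origin, its parallel subspace is its span.

  The identification with the normal cone does not need the biconjugate formula
  \<open>\<sigma>\<^sub>C\<^sup>* = \<delta>\<^sub>C\<close>, hence no separation theorem. It is enough that \<open>\<sigma>\<^sub>C\<^sup>*\<close> vanishes on \<open>C\<close>: a
  subgradient at \<open>z\<close>, tested at the points of \<open>C\<close>, is then a normal vector. Conversely, if
  \<open>v \<in> N\<^sub>C(z)\<close>, then \<open>\<sigma>\<^sub>C(v) = \<langle>v, z\<rangle>\<close>, and the term for \<open>v\<close> in the supremum that defines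
  \<open>\<sigma>\<^sub>C\<^sup>*(y)\<close> is \<open>\<langle>v, y - z\<rangle>\<close>, which is the subgradient inequality at an arbitrary \<open>y\<close>.\<close>

lemma inner_le_support_function:
  "x \<in> C \<Longrightarrow> ereal (inner v x) \<le> support_function C v"
  unfolding support_function_def by (rule SUP_upper)

lemma support_function_normal_cone:
  assumes "z \<in> C" and "v \<in> normal_cone C z"
  shows "support_function C v = ereal (inner v z)"
proof (rule antisym)
  show "support_function C v \<le> ereal (inner v z)"
    unfolding support_function_def using assms(2)
    by (intro SUP_least) (simp add: normal_cone_def inner_diff_right)
  show "ereal (inner v z) \<le> support_function C v"
    using assms(1) by (rule inner_le_support_function)
qed

lemma conjugate_support_function_eq_0:
  assumes "y \<in> C"
  shows "fenchel_conjugate (support_function C) y = 0"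
proof (rule antisym)
  show "fenchel_conjugate (support_function C) y \<le> 0"
    unfolding fenchel_conjugate_def
  proof (rule SUP_least)
    fix v
    have "ereal (inner y v) \<le> support_function C v"
      using inner_le_support_function[OF assms] by (simp add: inner_commute)
    then show "ereal (inner y v) - support_function C v \<le> 0"
      by (cases "support_function C v") auto
  qed
  have "support_function C 0 = 0"
    using support_function_normal_cone[OF assms, of 0]
    by (simp add: normal_cone_def zero_ereal_def)
  then have "0 = ereal (inner y 0) - support_function C 0"
    by (simp add: zero_ereal_def)
  also have "\<dots> \<le> fenchel_conjugate (support_function C) y"
    unfolding fenchel_conjugate_def by (rule SUP_upper) simp
  finally show "0 \<le> fenchel_conjugate (support_function C) y" .
qed

lemma subdifferential_conjugate_support_function:
  assumes "z \<in> C"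
  shows "subdifferential (fenchel_conjugate (support_function C)) z = normal_cone C z"
proof (intro equalityI subsetI)
  fix v
  assume v: "v \<in> subdifferential (fenchel_conjugate (support_function C)) z"
  have "inner v (y - z) \<le> 0" if "y \<in> C" for y
  proof -
    have "0 + ereal (inner v (y - z)) \<le> 0"
      using v conjugate_support_function_eq_0[OF assms] conjugate_support_function_eq_0[OF that]
      unfolding subdifferential_def by (metis (mono_tags, lifting) mem_Collect_eq)
    then show ?thesis by simp
  qed
  then show "v \<in> normal_cone C z"
    by (simp add: normal_cone_def)
next
  fix v
  assume v: "v \<in> normal_cone C z"
  have "ereal (inner v (y - z)) \<le> fenchel_conjugate (support_function C) y" for y
  proof -
    have "ereal (inner v (y - z)) = ereal (inner y v) - support_function C v"
      using support_function_normal_cone[OF assms v]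
      by (simp add: inner_diff_right inner_commute)
    also have "\<dots> \<le> fenchel_conjugate (support_function C) y"
      unfolding fenchel_conjugate_def by (rule SUP_upper) simp
    finally show ?thesis .
  qed
  then show "v \<in> subdifferential (fenchel_conjugate (support_function C)) z"
    by (simp add: subdifferential_def conjugate_support_function_eq_0[OF assms])
qed

theorem proposition4p1:
  fixes C :: "'a::real_inner set" and g :: "'a \<Rightarrow> ereal" and z :: 'a
  assumes "\<exists>B::'a set. finite B \<and> span B = UNIV"
    and "C \<noteq> {}" and "closed C" and "convex C"
    and "g = support_function C"
    and "z \<in> C"
  shows "par (subdifferential (fenchel_conjugate g) z) = span (normal_cone C z)"
proof -
  have "0 \<in> normal_cone C z"
    by (simp add: normal_cone_def)
  then have "par (normal_cone C z) = span (normal_cone C z)"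
    by (simp add: par_eq)
  then show ?thesis
    using assms(5,6) by (simp add: subdifferential_conjugate_support_function)
qed

end
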